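(* Let $p$ be a prime and let $G$ be a finite group with center $Z(G)$ such that $G/Z(G) \cong \mathbb{Z}_p\times\mathbb{Z}_p$. Then $$\text{L-Spec}(\Gamma_G) = \{0^{p+1},\ ((p-1)|Z(G)|)^{(p^2-1)|Z(G)|-p-1}\}$$ and $$\text{Q-Spec}(\Gamma_G) = \{(2(p-1)|Z(G)|-2)^{p+1},\ ((p-1)|Z(G)|-2)^{(p^2-1)|Z(G)|-p-1}\}.$$
   Context: The commuting graph $\Gamma_G$ of a finite non-abelian group $G$ is the simple undirected graph with vertex set $G\setminus Z(G)$ in which two distinct vertices $x,y$ are adjacent if and only if $xy=yx$. For a finite graph $\mathcal{G}$ with adjacency matrix $A$ and (diagonal) degree matrix $D$, $\text{L-Spec}(\mathcal{G})$ and $\text{Q-Spec}(\mathcal{G})$ denote the multisets of eigenvalues (with multiplicity) of the Laplacian matrix $D-A$ and of the signless Laplacian matrix $D+A$, respectively. The notation $\{\alpha_1^{a_1},\dots,\alpha_l^{a_l}\}$ means the multiset in which $\alpha_i$ is listed $a_i$ times (if listed values coincide, their multiplicities add; an exponent $0$ means the value does not appear). *)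

theory Defs
  imports
    "HOL-Algebra.Coset"
    "HOL-Algebra.Elementary_Groups"
    "Graph_Theory.Pair_Digraph"
    "Jordan_Normal_Form.Char_Poly"
begin

section \<open>Commuting graphs\<close>

definition center :: "('a, 'b) monoid_scheme \<Rightarrow> 'a set" where
  "center G = {z \<in> carrier G. \<forall>x \<in> carrier G. z \<otimes>\<^bsub>G\<^esub> x = x \<otimes>\<^bsub>G\<^esub> z}"

text \<open>
  A simple undirected graph is a loop-free symmetric digraph without parallel arcs
  (locale \<^locale>\<open>pair_graph\<close>): the edge between \<open>x\<close> and \<open>y\<close> is the pair of
  arcs \<open>(x, y)\<close>, \<open>(y, x)\<close>.
\<close>

definition commuting_graph :: "('a, 'b) monoid_scheme \<Rightarrow> 'a pair_pre_digraph" where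
  "commuting_graph G =
     \<lparr>pverts = carrier G - center G,
      parcs = {(x, y). x \<in> carrier G - center G \<and> y \<in> carrier G - center G \<and>
                       x \<noteq> y \<and> x \<otimes>\<^bsub>G\<^esub> y = y \<otimes>\<^bsub>G\<^esub> x}\<rparr>"

lemma (in group) center_normal: "center G \<lhd> G"
proof (rule normalI)
  show "subgroup (center G) G"
  proof (rule subgroupI)
    show "center G \<subseteq> carrier G" "center G \<noteq> {}"
      by (auto simp: center_def intro: exI[of _ \<one>])
  next
    fix a assume a: "a \<in> center G"
    then have ac: "a \<in> carrier G" by (simp add: center_def)
    have "inv a \<otimes> x = x \<otimes> inv a" if x: "x \<in> carrier G" for x
    proof -
      have "a \<otimes> x = x \<otimes> a" using a x by (simp add: center_def)
      then have "x = inv a \<otimes> (x \<otimes> a)" using ac x by (metis inv_solve_left m_closed)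
      then have "x = (inv a \<otimes> x) \<otimes> a" using ac x by (simp add: m_assoc)
      then show ?thesis using ac x by (metis inv_closed inv_solve_right m_closed)
    qed
    then show "inv a \<in> center G" using ac by (simp add: center_def)
  next
    fix a b assume ab: "a \<in> center G" "b \<in> center G"
    then have c: "a \<in> carrier G" "b \<in> carrier G" by (auto simp: center_def)
    have "a \<otimes> b \<otimes> x = x \<otimes> (a \<otimes> b)" if x: "x \<in> carrier G" for x
    proof -
      have bx: "b \<otimes> x = x \<otimes> b" and ax: "a \<otimes> x = x \<otimes> a"
        using ab x by (simp_all add: center_def)
      have "a \<otimes> b \<otimes> x = a \<otimes> (x \<otimes> b)" using c x by (simp only: m_assoc bx)
      also have "\<dots> = (a \<otimes> x) \<otimes> b" using c x by (simp only: m_assoc)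
      also have "\<dots> = x \<otimes> (a \<otimes> b)" using c x by (simp only: m_assoc ax)
      finally show ?thesis .
    qed
    then show "a \<otimes> b \<in> center G" using c by (simp add: center_def)
  qed
  show "\<forall>x\<in>carrier G. center G #> x = x <# center G"
    by (auto simp: r_coset_def l_coset_def center_def)
qed

lemma pair_graph_commuting_graph:
  assumes "finite (carrier G)"
  shows "pair_graph (commuting_graph G)"
proof
  have "parcs (commuting_graph G) \<subseteq> carrier G \<times> carrier G"
    by (auto simp: commuting_graph_def)
  then show "finite (parcs (commuting_graph G))"
    using assms by (meson finite_SigmaI finite_subset)
  show "symmetric (with_proj (commuting_graph G))"
    by (auto simp: symmetric_def commuting_graph_def intro!: symI)
qed (use assms in \<open>auto simp: commuting_graph_def\<close>)


section \<open>Laplacian and signless Laplacian spectra of a finite graph\<close>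

text \<open>The matrices are taken with respect to an enumeration \<open>vs\<close> of the vertices.\<close>

definition adjacency_mat :: "'v pair_pre_digraph \<Rightarrow> 'v list \<Rightarrow> complex mat" where
  "adjacency_mat \<Gamma> vs = mat (length vs) (length vs)
     (\<lambda>(i, j). if (vs ! i, vs ! j) \<in> parcs \<Gamma> then 1 else 0)"

definition degree_mat :: "'v pair_pre_digraph \<Rightarrow> 'v list \<Rightarrow> complex mat" where
  "degree_mat \<Gamma> vs = mat (length vs) (length vs)
     (\<lambda>(i, j). if i = j then of_nat (out_degree (with_proj \<Gamma>) (vs ! i)) else 0)"

definition laplacian_mat :: "'v pair_pre_digraph \<Rightarrow> 'v list \<Rightarrow> complex mat" where
  "laplacian_mat \<Gamma> vs = degree_mat \<Gamma> vs - adjacency_mat \<Gamma> vs"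

definition signless_laplacian_mat :: "'v pair_pre_digraph \<Rightarrow> 'v list \<Rightarrow> complex mat" where
  "signless_laplacian_mat \<Gamma> vs = degree_mat \<Gamma> vs + adjacency_mat \<Gamma> vs"

text \<open>Over the complex numbers this multiset has as many elements as the matrix has rows.\<close>

definition eigenvalue_mset :: "complex mat \<Rightarrow> complex multiset" where
  "eigenvalue_mset A = proots (char_poly A)"

definition vertex_enum :: "'v pair_pre_digraph \<Rightarrow> 'v list" where
  "vertex_enum \<Gamma> = (SOME vs. distinct vs \<and> set vs = pverts \<Gamma>)"

text \<open>
  The spectra do not depend on the chosen enumeration; see \<open>L_Spec_eq\<close> and
  \<open>Q_Spec_eq\<close> below.
\<close>

definition L_Spec :: "'v pair_pre_digraph \<Rightarrow> complex multiset" where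
  "L_Spec \<Gamma> = eigenvalue_mset (laplacian_mat \<Gamma> (vertex_enum \<Gamma>))"

definition Q_Spec :: "'v pair_pre_digraph \<Rightarrow> complex multiset" where
  "Q_Spec \<Gamma> = eigenvalue_mset (signless_laplacian_mat \<Gamma> (vertex_enum \<Gamma>))"

lemma size_eigenvalue_mset:
  assumes "A \<in> carrier_mat n n"
  shows "size (eigenvalue_mset A) = n"
  using degree_monic_char_poly[OF assms]
  by (simp add: eigenvalue_mset_def size_proots_complex)

lemma vertex_enum:
  assumes "finite (pverts \<Gamma>)"
  shows "distinct (vertex_enum \<Gamma>)" "set (vertex_enum \<Gamma>) = pverts \<Gamma>"
  using someI_ex[of "\<lambda>vs. distinct vs \<and> set vs = pverts \<Gamma>"]
    finite_distinct_list[OF assms] unfolding vertex_enum_def by blast+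

lemma similar_mat_reenumerate:
  fixes f :: "'v \<Rightarrow> 'v \<Rightarrow> 'c :: comm_ring_1"
  assumes vs: "distinct vs" and ws: "distinct ws" and eq: "set vs = set ws"
  shows "similar_mat (mat (length vs) (length vs) (\<lambda>(i, j). f (vs ! i) (vs ! j)))
                     (mat (length ws) (length ws) (\<lambda>(i, j). f (ws ! i) (ws ! j)))"
proof -
  define n where "n = length vs"
  have len: "length vs = n" "length ws = n"
    using vs ws eq by (auto simp: n_def distinct_card[symmetric])
  define A where "A = mat n n (\<lambda>(i, j). f (vs ! i) (vs ! j))"
  define B where "B = mat n n (\<lambda>(i, j). f (ws ! i) (ws ! j))"
  define T where "T us xs = mat n n (\<lambda>(i, j). if us ! i = xs ! j then 1 else 0 :: 'c)"
    for us xs :: "'v list"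
  have sum_enum: "(\<Sum>k = 0..<n. g (us ! k)) = sum g (set us)"
    if "distinct us" "length us = n" for g :: "'v \<Rightarrow> 'c" and us
    using that by (simp add: sum.distinct_set_conv_list sum_list_sum_nth)
  have TT: "T us xs * T xs us = 1\<^sub>m n"
    if "distinct us" "distinct xs" "length us = n" "length xs = n" "set us = set xs"
    for us xs
  proof (rule eq_matI)
    fix i j assume "i < dim_row (1\<^sub>m n :: 'c mat)" "j < dim_col (1\<^sub>m n :: 'c mat)"
    then have ij: "i < n" "j < n" by auto
    have mem: "us ! i \<in> set xs" using that ij nth_mem by metis
    have "(T us xs * T xs us) $$ (i, j) =
        (\<Sum>k = 0..<n. (\<lambda>v. (if us ! i = v then 1 else 0) * (if v = us ! j then 1 else 0)) (xs ! k))"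
      using ij by (simp add: T_def scalar_prod_def)
    also have "\<dots> = (\<Sum>v\<in>set xs. (if us ! i = v then (if v = us ! j then 1 else 0) else 0))"
      by (subst sum_enum[OF that(2,4), of "\<lambda>v. (if us ! i = v then 1 else 0) * (if v = us ! j then 1 else 0)"])
        (intro sum.cong, auto)
    also have "\<dots> = (if us ! i = us ! j then 1 else 0)"
      using mem by (simp add: sum.delta)
    also have "\<dots> = 1\<^sub>m n $$ (i, j)" using ij that by (simp add: nth_eq_iff_index_eq)
    finally show "(T us xs * T xs us) $$ (i, j) = 1\<^sub>m n $$ (i, j)" .
  qed (auto simp: T_def)
  have TB: "T vs ws * B = mat n n (\<lambda>(i, j). f (vs ! i) (ws ! j))"
  proof (rule eq_matI)
    fix i j assume "i < dim_row (mat n n (\<lambda>(i, j). f (vs ! i) (ws ! j)))"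
      "j < dim_col (mat n n (\<lambda>(i, j). f (vs ! i) (ws ! j)))"
    then have ij: "i < n" "j < n" by auto
    have mem: "vs ! i \<in> set ws" using len ij eq nth_mem by metis
    have "(T vs ws * B) $$ (i, j) =
        (\<Sum>k = 0..<n. (\<lambda>v. (if vs ! i = v then 1 else 0) * f v (ws ! j)) (ws ! k))"
      using ij by (simp add: T_def B_def scalar_prod_def)
    also have "\<dots> = (\<Sum>v\<in>set ws. if vs ! i = v then f v (ws ! j) else 0)"
      by (subst sum_enum[OF ws len(2), of "\<lambda>v. (if vs ! i = v then 1 else 0) * f v (ws ! j)"])
        (intro sum.cong, auto)
    also have "\<dots> = f (vs ! i) (ws ! j)" using mem by (simp add: sum.delta)
    finally show "(T vs ws * B) $$ (i, j) = mat n n (\<lambda>(i, j). f (vs ! i) (ws ! j)) $$ (i, j)"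
      using ij by simp
  qed (auto simp: T_def B_def)
  have "T vs ws * B * T ws vs = A"
  proof (rule eq_matI)
    fix i j assume "i < dim_row A" "j < dim_col A"
    then have ij: "i < n" "j < n" by (auto simp: A_def)
    have mem: "vs ! j \<in> set ws" using len ij eq nth_mem by metis
    have "(T vs ws * B * T ws vs) $$ (i, j) =
        (\<Sum>k = 0..<n. (\<lambda>v. f (vs ! i) v * (if v = vs ! j then 1 else 0)) (ws ! k))"
      unfolding TB using ij by (simp add: T_def scalar_prod_def)
    also have "\<dots> = (\<Sum>v\<in>set ws. if vs ! j = v then f (vs ! i) v else 0)"
      by (subst sum_enum[OF ws len(2), of "\<lambda>v. f (vs ! i) v * (if v = vs ! j then 1 else 0)"])
        (intro sum.cong, auto)
    also have "\<dots> = f (vs ! i) (vs ! j)" using mem by (simp add: sum.delta)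
    finally show "(T vs ws * B * T ws vs) $$ (i, j) = A $$ (i, j)"
      using ij by (simp add: A_def)
  qed (auto simp: T_def A_def B_def)
  then have "similar_mat A B"
    using TT[OF vs ws len eq] TT[OF ws vs len(2) len(1) eq[symmetric]]
    by (intro similar_matI[of _ _ "T vs ws" "T ws vs" n]) (auto simp: T_def A_def B_def)
  then show ?thesis by (simp add: A_def B_def len)
qed

lemma laplacian_mat_alt:
  assumes "distinct vs"
  shows "laplacian_mat \<Gamma> vs = mat (length vs) (length vs) (\<lambda>(i, j).
           (\<lambda>x y. (if x = y then of_nat (out_degree (with_proj \<Gamma>) x) else 0) -
                  (if (x, y) \<in> parcs \<Gamma> then 1 else 0)) (vs ! i) (vs ! j))"
  using assms
  by (intro eq_matI) (auto simp: laplacian_mat_def degree_mat_def adjacency_mat_def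
      nth_eq_iff_index_eq)

lemma signless_laplacian_mat_alt:
  assumes "distinct vs"
  shows "signless_laplacian_mat \<Gamma> vs = mat (length vs) (length vs) (\<lambda>(i, j).
           (\<lambda>x y. (if x = y then of_nat (out_degree (with_proj \<Gamma>) x) else 0) +
                  (if (x, y) \<in> parcs \<Gamma> then 1 else 0)) (vs ! i) (vs ! j))"
  using assms
  by (intro eq_matI) (auto simp: signless_laplacian_mat_def degree_mat_def adjacency_mat_def
      nth_eq_iff_index_eq)

lemma L_Spec_eq:
  assumes "distinct vs" "set vs = pverts \<Gamma>"
  shows "L_Spec \<Gamma> = eigenvalue_mset (laplacian_mat \<Gamma> vs)"
proof -
  have "finite (pverts \<Gamma>)" using assms(2) by (metis List.finite_set)
  note e = vertex_enum[OF this]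
  show ?thesis unfolding L_Spec_def eigenvalue_mset_def
      laplacian_mat_alt[OF assms(1)] laplacian_mat_alt[OF e(1)]
    by (rule arg_cong[OF char_poly_similar[OF similar_mat_reenumerate]])
      (use assms e in auto)
qed

lemma Q_Spec_eq:
  assumes "distinct vs" "set vs = pverts \<Gamma>"
  shows "Q_Spec \<Gamma> = eigenvalue_mset (signless_laplacian_mat \<Gamma> vs)"
proof -
  have "finite (pverts \<Gamma>)" using assms(2) by (metis List.finite_set)
  note e = vertex_enum[OF this]
  show ?thesis unfolding Q_Spec_def eigenvalue_mset_def
      signless_laplacian_mat_alt[OF assms(1)] signless_laplacian_mat_alt[OF e(1)]
    by (rule arg_cong[OF char_poly_similar[OF similar_mat_reenumerate]])
      (use assms e in auto)
qed

end

theory Submission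
  imports Defs "Jordan_Normal_Form.Schur_Decomposition"
begin

text \<open>Write Z for the center, z for its order and m = (p - 1) z. The isomorphism gives index
  p^2 for Z, so by Lagrange every subgroup strictly between Z and G has order p z
  (\<open>card_between\<close>). The centralizer C(x) of a non-central x is such a subgroup, and so
  is C(x) \<inter> C(y) as soon as it contains a non-central element; then C(x) = C(y)
  (\<open>centralizer_eq\<close>). Commuting is therefore an equivalence relation on the non-central
  elements, with classes C(x) - Z of size m. There are p + 1 of them, since p^2 z - z = (p + 1) m:
  the commuting graph is a disjoint union of p + 1 complete graphs on m vertices.

  The classes need not be listed to obtain the spectra. Let B = A + I be the 0/1 matrix of the
  commuting relation. Counting common commuting elements (\<open>card_common_centralizer\<close>)
  gives B^2 = m B, so each eigenvalue of B is 0 or m, and the trace (p + 1) m shows that m occurs p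
  + 1 times (\<open>eigenvalue_mset_multiple_of_idempotent\<close>,
  \<open>eigenvalue_mset_commuting\<close>). Every vertex has degree m - 1, so D - A = m I - B and D
  + A = (m - 2) I + B, which yields both spectra.\<close>

section \<open>Eigenvalues of multiples of idempotent matrices\<close>

text \<open>The trace is invariant under swapping factors; this moves the trace of a matrix to its
  Schur form.\<close>

lemma sum_list_diag_mat_mult_commute:
  fixes A B :: "'a :: comm_semiring_0 mat"
  assumes "A \<in> carrier_mat n m" "B \<in> carrier_mat m n"
  shows "sum_list (diag_mat (A * B)) = sum_list (diag_mat (B * A))"
proof -
  have "sum_list (diag_mat (A * B)) = (\<Sum>i = 0..<n. \<Sum>j = 0..<m. A $$ (i, j) * B $$ (j, i))"
    using assms by (simp add: diag_mat_def sum_list_sum_nth scalar_prod_def)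
  also have "\<dots> = (\<Sum>j = 0..<m. \<Sum>i = 0..<n. B $$ (j, i) * A $$ (i, j))"
    by (subst sum.swap) (simp add: mult.commute)
  also have "\<dots> = sum_list (diag_mat (B * A))"
    using assms by (simp add: diag_mat_def sum_list_sum_nth scalar_prod_def)
  finally show ?thesis .
qed

text \<open>For j \<noteq> i one of the positions (i, j), (j, i) lies below the diagonal, so only j
  = i contributes. A quadratic equation for T thus passes to each diagonal entry.\<close>

lemma upper_triangular_square_diag:
  fixes T :: "'a :: comm_semiring_1 mat"
  assumes "T \<in> carrier_mat n n" "upper_triangular T" "i < n"
  shows "(T * T) $$ (i, i) = T $$ (i, i) * T $$ (i, i)"
proof -
  have "(T * T) $$ (i, i) = (\<Sum>j = 0..<n. T $$ (i, j) * T $$ (j, i))"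
    using assms by (simp add: scalar_prod_def)
  also have "\<dots> = (\<Sum>j = 0..<n. if j = i then T $$ (i, i) * T $$ (i, i) else 0)"
  proof (intro sum.cong refl)
    fix j assume "j \<in> {0..<n}"
    then show "T $$ (i, j) * T $$ (j, i) = (if j = i then T $$ (i, i) * T $$ (i, i) else 0)"
      using assms upper_triangularD[OF assms(2), of j i] upper_triangularD[OF assms(2), of i j]
      by (cases i j rule: linorder_cases) auto
  qed
  also have "\<dots> = T $$ (i, i) * T $$ (i, i)" using assms by simp
  finally show ?thesis .
qed

text \<open>In characteristic 0 the sum determines how often the nonzero value occurs. Applied to
  the diagonal of a triangular matrix, it reads multiplicities off the trace.\<close>

lemma mset_two_values:
  fixes xs :: "'a :: field_char_0 list"
  assumes "set xs \<subseteq> {0, m}" "m \<noteq> 0" "sum_list xs = of_nat k * m"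
  shows "mset xs = replicate_mset k m + replicate_mset (length xs - k) 0"
  using assms
proof (induction xs arbitrary: k)
  case (Cons x xs)
  show ?case
  proof (cases "x = 0")
    case True
    then have IH: "mset xs = replicate_mset k m + replicate_mset (length xs - k) 0"
      using Cons by simp
    \<comment> \<open>Natural subtraction truncates, so comparing sizes in the induction hypothesis
      yields this bound, which makes the step to \<open>Suc (length xs) - k\<close> exact.\<close>
    have "k \<le> length xs"
      using arg_cong[OF IH, of size] by simp
    then show ?thesis using IH True by (simp add: Suc_diff_le)
  next
    case False
    then have x: "x = m" using Cons by auto
    then have s: "sum_list xs = (of_nat k - 1) * m"
      using Cons.prems(3) by (simp add: algebra_simps eq_diff_eq)
    have "k \<noteq> 0"
    proof
      assume "k = 0"
      \<comment> \<open>With k = 0 the tail would sum to -m; but its sum is a natural multiple of m,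
        so a positive multiple of m would vanish.\<close>
      moreover have "sum_list ys = of_nat (count_list ys m) * m"
        if "set ys \<subseteq> {0, m}" for ys
        using that \<open>m \<noteq> 0\<close> by (induction ys) (auto simp: algebra_simps)
      ultimately have "of_nat (count_list xs m) * m = - m"
        using s Cons.prems(1) by simp
      then have "(of_nat (Suc (count_list xs m)) :: 'a) * m = 0"
        by (simp add: algebra_simps)
      then show False using \<open>m \<noteq> 0\<close> by (simp del: of_nat_Suc)
    qed
    then obtain l where l: "k = Suc l" by (cases k) auto
    then have "mset xs = replicate_mset l m + replicate_mset (length xs - l) 0"
      using Cons s by simp
    then show ?thesis using x l by simp
  qed
qed auto

lemma proots_linear_factors:
  fixes xs :: "'a :: idom list"
  shows "proots (\<Prod>a\<leftarrow>xs. [:- a, 1:]) = mset xs"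
proof (induction xs)
  case (Cons a xs)
  have "(\<Prod>a\<leftarrow>xs. [:- a, 1:]) \<noteq> 0" by auto
  then show ?case using Cons by (simp add: proots_mult del: mult_pCons_left)
qed auto

text \<open>A triangular form T of B also satisfies T^2 = m T, so its diagonal entries solve t^2 = m
  t, and the trace counts those equal to m. The same change of basis makes a I + s B triangular with
  diagonal entries a + s t.\<close>

lemma eigenvalue_mset_multiple_of_idempotent:
  assumes B: "B \<in> carrier_mat n n" and BB: "B * B = m \<cdot>\<^sub>m B" and m: "m \<noteq> 0"
    and tr: "sum_list (diag_mat B) = of_nat k * m"
  shows "eigenvalue_mset (a \<cdot>\<^sub>m 1\<^sub>m n + s \<cdot>\<^sub>m B) =
           replicate_mset k (a + s * m) + replicate_mset (n - k) a"
proof -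
  obtain es where es: "char_poly B = (\<Prod>e\<leftarrow>es. [:- e, 1:])"
    using char_poly_factorized[OF B] by blast
  obtain T P Q where dec: "schur_decomposition B es = (T, P, Q)"
    by (cases "schur_decomposition B es") auto
  from schur_decomposition[OF B es dec]
  have wit: "similar_mat_wit B T P Q" and ut: "upper_triangular T" by auto
  note w = similar_mat_witD2[OF B wit]
  have T: "T \<in> carrier_mat n n" and P: "P \<in> carrier_mat n n" and Q: "Q \<in> carrier_mat n n"
    using w by auto
  have TB: "T = Q * B * P"
    using similar_mat_witD2(3)[OF T similar_mat_wit_sym[OF wit]] .
  have TT: "T * T = m \<cdot>\<^sub>m T"
  proof -
    have "T * T = Q * B * (P * Q) * B * P"
      unfolding TB using P Q B by (simp add: assoc_mult_mat[of _ n n _ n _ n])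
    also have "\<dots> = Q * (B * B) * P"
      using w P Q B by (simp add: assoc_mult_mat[of _ n n _ n _ n])
    also have "\<dots> = m \<cdot>\<^sub>m T"
      unfolding BB TB using P Q B
      by (simp add: mult_smult_distrib[of _ n n _ n] mult_smult_assoc_mat[of _ n n _ n])
    finally show ?thesis .
  qed
  have "sum_list (diag_mat T) = sum_list (diag_mat (P * (Q * B)))"
    unfolding TB by (rule sum_list_diag_mat_mult_commute[of _ n n]) (use P Q B in auto)
  also have "P * (Q * B) = P * Q * B"
    using assoc_mult_mat[OF P Q B] by simp
  also have "\<dots> = B" using w B by simp
  finally have trT: "sum_list (diag_mat T) = of_nat k * m" using tr by simp
  have "T $$ (i, i) \<in> {0, m}" if "i < n" for i
    using upper_triangular_square_diag[OF T ut that] that T unfolding TT by auto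
  then have "set (diag_mat T) \<subseteq> {0, m}"
    using T by (fastforce simp: diag_mat_def)
  from mset_two_values[OF this m trT]
  have mT: "mset (diag_mat T) = replicate_mset k m + replicate_mset (n - k) 0"
    using T by (simp add: diag_mat_def)
  define A where "A = a \<cdot>\<^sub>m 1\<^sub>m n + s \<cdot>\<^sub>m B"
  define U where "U = a \<cdot>\<^sub>m 1\<^sub>m n + s \<cdot>\<^sub>m T"
  have U: "U \<in> carrier_mat n n" using T by (simp add: U_def)
  have "P * U * Q = (a \<cdot>\<^sub>m P + s \<cdot>\<^sub>m (P * T)) * Q"
    unfolding U_def using P T
    by (simp add: mult_add_distrib_mat[of _ n n _ n] mult_smult_distrib[of _ n n _ n])
  also have "\<dots> = a \<cdot>\<^sub>m (P * Q) + s \<cdot>\<^sub>m (P * T * Q)"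
    using P T Q
    by (simp add: add_mult_distrib_mat[of _ n n _ _ n] mult_smult_assoc_mat[of _ n n _ n])
  also have "\<dots> = A" unfolding A_def using w by simp
  finally have "similar_mat A U"
    using w P Q U B by (intro similar_matI[of _ _ P Q n]) (auto simp: A_def)
  then have "char_poly A = char_poly U" by (rule char_poly_similar)
  also have "\<dots> = (\<Prod>e\<leftarrow>diag_mat U. [:- e, 1:])"
    by (rule char_poly_upper_triangular[OF U])
      (use ut T in \<open>auto simp: U_def upper_triangular_def\<close>)
  finally have "eigenvalue_mset A = mset (diag_mat U)"
    by (simp add: eigenvalue_mset_def proots_linear_factors)
  also have "diag_mat U = map (\<lambda>t. a + s * t) (diag_mat T)"
    using T by (simp add: U_def diag_mat_def)
  also have "mset \<dots> = replicate_mset k (a + s * m) + replicate_mset (n - k) a"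
    by (simp add: mT)
  finally show ?thesis by (simp add: A_def)
qed

section \<open>Groups whose central quotient has order the square of a prime\<close>

context group
begin

definition centralizer :: "'a \<Rightarrow> 'a set" where
  "centralizer x = {y \<in> carrier G. x \<otimes> y = y \<otimes> x}"

lemma subgroup_centralizer:
  assumes x: "x \<in> carrier G"
  shows "subgroup (centralizer x) G"
proof (rule subgroupI)
  fix a assume "a \<in> centralizer x"
  then have a: "a \<in> carrier G" "x \<otimes> a = a \<otimes> x" by (auto simp: centralizer_def)
  have "x = inv a \<otimes> (x \<otimes> a)" using a x by (metis inv_solve_left m_closed)
  then have "x = inv a \<otimes> x \<otimes> a" using a(1) x by (simp add: m_assoc)
  then have "inv a \<otimes> x = x \<otimes> inv a"
    using a(1) x by (metis inv_closed inv_solve_right m_closed)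
  then show "inv a \<in> centralizer x" using a by (simp add: centralizer_def)
next
  fix a b assume "a \<in> centralizer x" "b \<in> centralizer x"
  then have a: "a \<in> carrier G" "x \<otimes> a = a \<otimes> x" and b: "b \<in> carrier G" "x \<otimes> b = b \<otimes> x"
    by (auto simp: centralizer_def)
  have "x \<otimes> (a \<otimes> b) = a \<otimes> (x \<otimes> b)"
    using a b(1) x by (simp flip: m_assoc)
  also have "\<dots> = a \<otimes> b \<otimes> x" using a(1) b x by (simp add: m_assoc)
  finally show "a \<otimes> b \<in> centralizer x" using a b by (simp add: centralizer_def)
qed (use x in \<open>auto simp: centralizer_def\<close>)

lemma center_subset_centralizer:
  assumes "x \<in> carrier G"
  shows "center G \<subseteq> centralizer x"
  using assms by (auto simp: center_def centralizer_def)

lemma centralizer_eq_carrier_iff: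
  assumes "x \<in> carrier G"
  shows "centralizer x = carrier G \<longleftrightarrow> x \<in> center G"
  using assms by (auto simp: center_def centralizer_def)

lemma card_subgroup_dvd:
  assumes "subgroup H G" "subgroup K G" "H \<subseteq> K"
  shows "card H dvd card K"
proof -
  interpret K: group "G\<lparr>carrier := K\<rparr>"
    using assms(2) subgroup.subgroup_is_group is_group by blast
  have "card (rcosets\<^bsub>G\<lparr>carrier := K\<rparr>\<^esub> H) * card H = card K"
    using K.lagrange[OF subgroup_incl[OF assms]] by (simp add: Coset.order_def)
  then show ?thesis by (metis dvd_triv_right)
qed

end

section \<open>Centralizers when the center has index p^2\<close>

locale central_quotient_prime_square = group G for G (structure) +
  fixes p :: nat
  assumes prime_p: "prime p"
    and finite_carrier: "finite (carrier G)"
    and card_rcosets_center: "card (rcosets center G) = p\<^sup>2"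
begin

abbreviation z :: nat where "z \<equiv> card (center G)"

lemma subgroup_center: "subgroup (center G) G"
  by (rule normal_imp_subgroup[OF center_normal])

lemma card_carrier: "card (carrier G) = p\<^sup>2 * z"
  using lagrange[OF subgroup_center] card_rcosets_center by (simp add: Coset.order_def)

lemma card_center_pos: "z > 0"
  using subgroup.finite_imp_card_positive[OF subgroup_center finite_carrier] .

text \<open>The index of the center in H divides p^2 and, both inclusions being strict, is neither 1
  nor p^2.\<close>

lemma card_between:
  assumes H: "subgroup H G" and "center G \<subset> H" "H \<subset> carrier G"
  shows "card H = p * z"
proof -
  have fin: "finite H" using assms finite_carrier finite_subset by blast
  obtain d where d: "card H = z * d"
    using card_subgroup_dvd[OF subgroup_center H] assms by (auto elim: dvdE)
  have "z * d dvd z * p\<^sup>2"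
    using card_subgroup_dvd[OF H subgroup_self] assms d card_carrier
    by (simp add: mult.commute psubset_imp_subset)
  then have "d dvd p\<^sup>2" using card_center_pos by simp
  then obtain i where i: "i \<le> 2" "d = p ^ i"
    using divides_primepow_nat[OF prime_p] by blast
  have "z < card H" using psubset_card_mono[OF fin] assms by blast
  then have "i \<noteq> 0" using d i by (cases i) auto
  moreover have "card H < p\<^sup>2 * z"
    using psubset_card_mono[OF finite_carrier] assms card_carrier by metis
  then have "i \<noteq> 2" using d i by auto
  ultimately have "i = 1" using i by simp
  then show ?thesis using d i by simp
qed

lemma centralizer_psubsets:
  assumes "x \<in> carrier G - center G"
  shows "center G \<subset> centralizer x" "centralizer x \<subset> carrier G"
proof -
  have "x \<in> centralizer x" using assms by (simp add: centralizer_def)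
  then show "center G \<subset> centralizer x" using assms center_subset_centralizer by blast
  show "centralizer x \<subset> carrier G"
    using assms centralizer_eq_carrier_iff by (auto simp: centralizer_def)
qed

lemma card_centralizer:
  assumes "x \<in> carrier G - center G"
  shows "card (centralizer x) = p * z"
  using assms by (intro card_between subgroup_centralizer centralizer_psubsets) auto

(* A non-central common element makes the intersection of the two centralizers a subgroup
   strictly between the center and the group, so all three have the same order. *)
lemma centralizer_eq:
  assumes x: "x \<in> carrier G - center G" and y: "y \<in> carrier G - center G"
    and v: "v \<in> carrier G - center G" "v \<in> centralizer x" "v \<in> centralizer y"
  shows "centralizer x = centralizer y"
proof -
  let ?I = "centralizer x \<inter> centralizer y"
  have "card ?I = p * z"
  proof (rule card_between)
    show "subgroup ?I G"
      using x y by (intro subgroups_Inter_pair subgroup_centralizer) auto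
    show "center G \<subset> ?I"
      using x y v center_subset_centralizer by blast
    show "?I \<subset> carrier G" using centralizer_psubsets[OF x] by blast
  qed
  moreover have "finite (centralizer x)" "finite (centralizer y)"
    using finite_carrier by (auto simp: centralizer_def)
  ultimately have "?I = centralizer x" "?I = centralizer y"
    using card_centralizer[OF x] card_centralizer[OF y] by (simp_all add: card_subset_eq)
  then show ?thesis by simp
qed

text \<open>For the 0/1 matrix B of the commuting relation, this cardinality is the (x, y) entry of
  B^2; the equations are oriented to match the factors B(x, v) and B(v, y).\<close>

lemma card_common_centralizer:
  assumes x: "x \<in> carrier G - center G" and y: "y \<in> carrier G - center G"
  shows "card {v \<in> carrier G - center G. x \<otimes> v = v \<otimes> x \<and> v \<otimes> y = y \<otimes> v} =
    (if x \<otimes> y = y \<otimes> x then (p - 1) * z else 0)"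
    (is "card ?V = _")
proof -
  have V: "?V = (centralizer x \<inter> centralizer y) - center G"
    by (auto simp: centralizer_def)
  have fin: "finite (center G)" using finite_carrier by (simp add: center_def)
  show ?thesis
  proof (cases "x \<otimes> y = y \<otimes> x")
    case True
    then have "centralizer x = centralizer y"
      \<comment> \<open>The shared non-central element is x itself.\<close>
      using x y by (intro centralizer_eq[of x y x]) (auto simp: centralizer_def)
    then have "card ?V = p * z - z"
      using V card_centralizer[OF x] centralizer_psubsets(1)[OF x] fin
      by (simp add: card_Diff_subset psubset_imp_subset)
    then show ?thesis using True by (simp add: diff_mult_distrib)
  next
    case False
    \<comment> \<open>A common v would make the centralizers equal, putting y into that of
      x.\<close>
    have "?V = {}"
    proof (rule ccontr)
      assume "?V \<noteq> {}"
      then obtain v where "v \<in> carrier G - center G" "v \<in> centralizer x" "v \<in> centralizer y"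
        unfolding V by (auto simp: centralizer_def)
      then have "centralizer x = centralizer y" using centralizer_eq[OF x y] by blast
      moreover have "y \<in> centralizer y" using y by (simp add: centralizer_def)
      ultimately have "y \<in> centralizer x" by simp
      then show False using False by (simp add: centralizer_def)
    qed
    then have "card ?V = 0" by (simp only: card.empty)
    then show ?thesis using False by simp
  qed
qed

section \<open>From centralizers to the spectra of the commuting graph\<close>

lemma out_degree_commuting_graph:
  assumes x: "x \<in> carrier G - center G"
  shows "out_degree (with_proj (commuting_graph G)) x = (p - 1) * z - 1"
proof -
  \<comment> \<open>The repeated condition is the common centralizer set at y = x; x is then removed
    because the graph has no loops.\<close>
  let ?V = "{v \<in> carrier G - center G. x \<otimes> v = v \<otimes> x \<and> v \<otimes> x = x \<otimes> v}"
  have "out_arcs (with_proj (commuting_graph G)) x = Pair x ` (?V - {x})"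
    using x by (auto simp: out_arcs_def commuting_graph_def)
  then have "out_degree (with_proj (commuting_graph G)) x = card (?V - {x})"
    by (simp add: out_degree_def card_image inj_on_def)
  also have "\<dots> = (p - 1) * z - 1"
    using x card_common_centralizer[OF x x] by (subst card_Diff_singleton) auto
  finally show ?thesis .
qed

text \<open>The factored form shows the number of classes times their size, hence the multiplicity p
  + 1 in the trace.\<close>

lemma card_noncentral: "card (carrier G - center G) = (p + 1) * ((p - 1) * z)"
proof -
  have "card (carrier G - center G) = p\<^sup>2 * z - z"
    using card_carrier finite_carrier subgroup.subset[OF subgroup_center]
    by (simp add: card_Diff_subset finite_subset)
  also have "\<dots> = (p + 1) * ((p - 1) * z)"
    using prime_gt_0_nat[OF prime_p] by (cases p) (auto simp: power2_eq_square algebra_simps)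
  finally show ?thesis .
qed

(* The commuting relation, including the diagonal, is an equivalence whose classes all have
   (p - 1) z elements; hence its 0/1 matrix B satisfies B^2 = (p - 1) z B, and the two
   Laplacians are affine functions of B. *)
lemma eigenvalue_mset_commuting:
  fixes vs :: "'a list" and a s :: complex
  defines "n \<equiv> length vs"
  assumes vs: "distinct vs" "set vs = carrier G - center G"
  shows "eigenvalue_mset (a \<cdot>\<^sub>m 1\<^sub>m n + s \<cdot>\<^sub>m
             mat n n (\<lambda>(i, j). if vs ! i \<otimes> vs ! j = vs ! j \<otimes> vs ! i then 1 else 0)) =
           replicate_mset (p + 1) (a + s * of_nat ((p - 1) * z)) +
           replicate_mset ((p\<^sup>2 - 1) * z - p - 1) a"
    (is "eigenvalue_mset (_ + _ \<cdot>\<^sub>m ?B) = _")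
proof -
  let ?m = "(p - 1) * z"
  have n: "n = (p + 1) * ?m" using vs card_noncentral by (simp add: n_def flip: distinct_card)
  have "?B * ?B = of_nat ?m \<cdot>\<^sub>m ?B"
  proof (rule eq_matI)
    fix i j assume "i < dim_row (of_nat ?m \<cdot>\<^sub>m ?B)" "j < dim_col (of_nat ?m \<cdot>\<^sub>m ?B)"
    then have ij: "i < n" "j < n" by auto
    define x y where "x = vs ! i" and "y = vs ! j"
    have xy: "x \<in> carrier G - center G" "y \<in> carrier G - center G"
      using ij vs(2) nth_mem by (auto simp: x_def y_def n_def)
    let ?g = "\<lambda>v. if x \<otimes> v = v \<otimes> x \<and> v \<otimes> y = y \<otimes> v then 1 else 0 :: complex"
    have "(?B * ?B) $$ (i, j) = (\<Sum>k = 0..<n. ?g (vs ! k))"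
      using ij by (auto simp: scalar_prod_def x_def y_def intro!: sum.cong)
    also have "\<dots> = sum ?g (set vs)"
      using vs(1) by (simp add: sum.distinct_set_conv_list sum_list_sum_nth n_def)
    also have "\<dots> = of_nat (card {v \<in> carrier G - center G. x \<otimes> v = v \<otimes> x \<and> v \<otimes> y = y \<otimes> v})"
      using finite_carrier vs(2) by (simp flip: sum.inter_filter)
    also have "\<dots> = (of_nat ?m \<cdot>\<^sub>m ?B) $$ (i, j)"
      using ij by (simp only: card_common_centralizer[OF xy]) (simp add: x_def y_def)
    finally show "(?B * ?B) $$ (i, j) = (of_nat ?m \<cdot>\<^sub>m ?B) $$ (i, j)" .
  qed auto
  moreover have "(of_nat ?m :: complex) \<noteq> 0"
    using prime_gt_1_nat[OF prime_p] card_center_pos by simp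
  \<comment> \<open>Each element commutes with itself, so the diagonal consists of ones.\<close>
  moreover have "sum_list (diag_mat ?B) = of_nat n"
    by (simp add: diag_mat_def sum_list_sum_nth)
  then have "sum_list (diag_mat ?B) = of_nat (p + 1) * of_nat ?m"
    by (simp only: n of_nat_mult)
  ultimately have "eigenvalue_mset (a \<cdot>\<^sub>m 1\<^sub>m n + s \<cdot>\<^sub>m ?B) =
      replicate_mset (p + 1) (a + s * of_nat ?m) + replicate_mset (n - (p + 1)) a"
    by (intro eigenvalue_mset_multiple_of_idempotent) auto
  moreover have "n - (p + 1) = (p\<^sup>2 - 1) * z - p - 1"
    unfolding n by (cases p) (auto simp: power2_eq_square algebra_simps)
  ultimately show ?thesis by simp
qed

lemma commuting_graph_spectra:
  shows "L_Spec (commuting_graph G) =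
           replicate_mset (p + 1) 0 +
           replicate_mset ((p\<^sup>2 - 1) * z - p - 1) ((of_nat p - 1) * of_nat z)" (is ?L)
    and "Q_Spec (commuting_graph G) =
           replicate_mset (p + 1) (2 * (of_nat p - 1) * of_nat z - 2) +
           replicate_mset ((p\<^sup>2 - 1) * z - p - 1) ((of_nat p - 1) * of_nat z - 2)" (is ?Q)
proof -
  obtain vs where vs: "distinct vs" "set vs = carrier G - center G"
    using finite_distinct_list finite_carrier by (metis finite_Diff)
  then have pv: "set vs = pverts (commuting_graph G)" by (simp add: commuting_graph_def)
  define n where "n = length vs"
  define m :: complex where "m = (of_nat p - 1) * of_nat z"
  define B :: "complex mat" where
    "B = mat n n (\<lambda>(i, j). if vs ! i \<otimes> vs ! j = vs ! j \<otimes> vs ! i then 1 else 0)"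
  have p: "p > 1" using prime_p by (rule prime_gt_1_nat)
  have m: "of_nat ((p - 1) * z) = m"
    using p by (simp add: m_def of_nat_diff)
  have deg: "of_nat (out_degree (with_proj (commuting_graph G)) (vs ! i)) = m - 1" if "i < n" for i
  proof -
    have "vs ! i \<in> carrier G - center G" using that vs(2) nth_mem unfolding n_def by blast
    \<comment> \<open>This makes the truncated \<open>- 1\<close> in the degree a true subtraction
      over the complex numbers.\<close>
    moreover have "(p - 1) * z \<ge> 1" using p card_center_pos by (simp add: Suc_le_eq)
    ultimately show ?thesis
      using m by (simp only: out_degree_commuting_graph of_nat_diff of_nat_1)
  qed
  have arc: "(vs ! i, vs ! j) \<in> parcs (commuting_graph G) \<longleftrightarrow>
      i \<noteq> j \<and> vs ! i \<otimes> vs ! j = vs ! j \<otimes> vs ! i" if "i < n" "j < n" for i j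
    using that vs nth_mem[of i vs] nth_mem[of j vs]
    by (auto simp: commuting_graph_def n_def nth_eq_iff_index_eq)
  \<comment> \<open>Since A = B - I and D = (m - 1) I, this is D - A; the eigenvalues m and 0 of B
    become 0 and m.\<close>
  have "laplacian_mat (commuting_graph G) vs = m \<cdot>\<^sub>m 1\<^sub>m n + (-1) \<cdot>\<^sub>m B"
    by (rule eq_matI)
      (auto simp: laplacian_mat_def degree_mat_def adjacency_mat_def B_def deg arc simp flip: n_def)
  then show ?L
    using L_Spec_eq[OF vs(1) pv] eigenvalue_mset_commuting[OF vs, of m "-1"]
    unfolding m by (simp add: B_def n_def m_def)
  \<comment> \<open>Likewise D + A = (m - 1) I + (B - I), with eigenvalues 2 m - 2 and m -
    2.\<close>
  have "signless_laplacian_mat (commuting_graph G) vs = (m - 2) \<cdot>\<^sub>m 1\<^sub>m n + 1 \<cdot>\<^sub>m B"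
    by (rule eq_matI)
      (auto simp: signless_laplacian_mat_def degree_mat_def adjacency_mat_def B_def deg arc
        simp flip: n_def)
  moreover have "m - 2 + 1 * m = 2 * (of_nat p - 1) * of_nat z - 2"
    by (simp add: m_def algebra_simps)
  ultimately show ?Q
    using Q_Spec_eq[OF vs(1) pv] eigenvalue_mset_commuting[OF vs, of "m - 2" 1]
    unfolding m B_def n_def by (simp only: m_def)
qed

end

theorem theorem2p3:
  fixes p :: nat and G :: "('a, 'b) monoid_scheme"
  assumes "prime p"
    and "group G"
    and "finite (carrier G)"
    and "G Mod center G \<cong> integer_mod_group p \<times>\<times> integer_mod_group p"
  shows "L_Spec (commuting_graph G) =
           replicate_mset (p + 1) 0 +
           replicate_mset ((p\<^sup>2 - 1) * card (center G) - p - 1)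
             ((of_nat p - 1) * of_nat (card (center G))) \<and>
         Q_Spec (commuting_graph G) =
           replicate_mset (p + 1) (2 * (of_nat p - 1) * of_nat (card (center G)) - 2) +
           replicate_mset ((p\<^sup>2 - 1) * card (center G) - p - 1)
             ((of_nat p - 1) * of_nat (card (center G)) - 2)"
proof -
  \<comment> \<open>The isomorphism is turned into the index p^2 of the center.\<close>
  have "card (rcosets\<^bsub>G\<^esub> center G) = card (carrier (G Mod center G))"
    by (simp add: FactGroup_def)
  also have "\<dots> = card (carrier (integer_mod_group p \<times>\<times> integer_mod_group p))"
    by (rule iso_same_card[OF assms(4)])
  also have "\<dots> = p\<^sup>2"
    using prime_gt_0_nat[OF assms(1)]
    by (simp add: carrier_integer_mod_group power2_eq_square)
  finally interpret central_quotient_prime_square G p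
    using assms by (intro central_quotient_prime_square.intro)
      (auto simp: central_quotient_prime_square_axioms_def)
  show ?thesis using commuting_graph_spectra by blast
qed

end
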